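(* Let $M$ be a positive integer congruent to $2$ or $3$ modulo $5$, and let $n\ge 1$ and $k\ge 0$ be integers. Then the number of partitions of $n$ into parts congruent to $2$ or $3$ modulo $5$ in which the part $M$ occurs exactly $k$ times is equal to the number of partitions $\lambda=(\lambda_1\ge\lambda_2\ge\cdots)$ of $n$ with difference at least $2$, with no part equal to $1$, satisfying: (1) if $\lambda$ has exactly one part, then $n=Mk+j$ for some integer $j$ with $2\le j\le M-1$, or $j=0$, or $j=M+1$; (2) if $\lambda$ has at least two parts, then $\lfloor(\lambda_1-\lambda_2-2)/M\rfloor=k$.
   Context: A partition $\lambda=(\lambda_1\ge\lambda_2\ge\cdots\ge\lambda_\ell\ge 1)$ has "difference at least $2$" if $\lambda_i-\lambda_{i+1}\ge 2$ for all $1\le i<\ell$ (a one-part partition satisfies this vacuously). *)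

theory Defs
  imports Complex_Main
begin

text \<open>A partition is the list of its parts in weakly decreasing order, so the part
  \<open>\<lambda>\<^sub>i\<close> is the list entry with index \<open>i - 1\<close>.\<close>

definition is_partition :: "nat \<Rightarrow> nat list \<Rightarrow> bool" where
  "is_partition n xs \<longleftrightarrow>
     sorted_wrt (\<ge>) xs \<and> (\<forall>x \<in> set xs. x \<ge> 1) \<and> sum_list xs = n"

definition difference_at_least_2 :: "nat list \<Rightarrow> bool" where
  "difference_at_least_2 xs \<longleftrightarrow>
     (\<forall>i. Suc i < length xs \<longrightarrow> int (xs ! i) - int (xs ! Suc i) \<ge> 2)"

end

theory Submission
  imports Defs "HOL-Computational_Algebra.Formal_Power_Series" "HOL-Library.Multiset"
begin

text \<open>
  Let \<open>A m\<close> count the partitions of \<open>m\<close> into parts congruent to 2 or 3 modulo 5, and \<open>B m\<close>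
  those with difference at least 2 and no part 1; both are 0 for negative \<open>m\<close>.

  Deleting copies of \<open>M\<close> shows that \<open>A (n - c * M)\<close> partitions counted by \<open>A n\<close> contain \<open>M\<close> at
  least \<open>c\<close> times, so exactly \<open>A (n - k * M) - A (n - (k + 1) * M)\<close> of them contain it \<open>k\<close> times.
  On the other side, lowering the largest part by \<open>c\<close> is a bijection from the partitions of \<open>n\<close>
  whose first two parts differ by at least \<open>2 + c\<close> onto all partitions of \<open>n - c\<close> with at least
  two parts. Hence the floor condition selects a difference of the same shape, with \<open>B\<close> in place
  of \<open>A\<close>, except that partitions with at most one part are missing from \<open>B\<close>. There is one such
  partition of \<open>m\<close> if \<open>m = 0\<close> or \<open>m \<ge> 2\<close> and none otherwise, and the condition on
  one-part partitions puts back precisely the difference of these corrections. The statement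
  therefore follows from \<open>A = B\<close>, the second Rogers-Ramanujan identity (\<open>rogers_ramanujan_second\<close>).

  That identity is proved through Schur's finite form. The generating polynomials of the
  partitions counted by \<open>B\<close> with parts at most \<open>n\<close> satisfy a two-term recurrence, and so does an
  alternating sum of Gaussian binomials (\<open>schur_poly_eq_alternating_sum\<close>). Multiplied by
  \<open>(1 - q) (1 - q\<^sup>2) (1 - q\<^sup>3) \<dots>\<close>, the central Gaussian binomials tend to 1, and what
  remains of the sum is the theta series \<open>\<Sum>j. (-1)^j q^(j (5 j - 3) / 2)\<close>. A finite form of
  Jacobi's triple product in base \<open>q\<^sup>5\<close> turns the same series into the product of the factors
  \<open>1 - q^i\<close> with \<open>i\<close> congruent to 0, 1 or 4 modulo 5; dividing by all factors leaves the
  generating function of \<open>A\<close>. Every limit is expressed as a congruence modulo \<open>q ^ T\<close> in an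
  arbitrary commutative ring, and only the last step specialises \<open>q\<close> to the variable of the
  integer power series.
\<close>

section \<open>Gaussian binomials\<close>

text \<open>Exponents below are quadratic polynomials in an integer summation index. Negative exponents occur
  only next to a vanishing Gaussian binomial, so the value 0 there is harmless.\<close>
definition ipow :: "'a::comm_ring_1 \<Rightarrow> int \<Rightarrow> 'a" where
  "ipow q e = (if e < 0 then 0 else q ^ nat e)"

lemma ipow_0 [simp]: "ipow q 0 = 1"
  by (simp add: ipow_def)

lemma ipow_of_nat: "ipow q (int n) = q ^ n"
  by (simp add: ipow_def)

lemma ipow_add: "a \<ge> 0 \<Longrightarrow> b \<ge> 0 \<Longrightarrow> ipow q (a + b) = ipow q a * ipow q b"
  by (simp add: ipow_def nat_add_distrib power_add)

text \<open>The Gaussian binomial with an integer lower index. Being 0 outside \<open>{0..n}\<close>, it lets all sums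
  run over ranges that do not depend on \<open>n\<close>.\<close>
primrec gauss :: "'a::comm_ring_1 \<Rightarrow> nat \<Rightarrow> int \<Rightarrow> 'a" where
  "gauss q 0 k = (if k = 0 then 1 else 0)"
| "gauss q (Suc n) k = gauss q n (k - 1) + ipow q k * gauss q n k"

lemma gauss_outside: "k < 0 \<or> k > int n \<Longrightarrow> gauss q n k = 0"
  by (induction n arbitrary: k) (auto simp: ipow_def)

lemma gauss_pascal_dual:
  "gauss q (Suc n) k = ipow q (int (Suc n) - k) * gauss q n (k - 1) + gauss q n k"
proof (induction n arbitrary: k)
  case 0
  show ?case by (auto simp: ipow_def)
next
  case (Suc n)
  \<comment> \<open>Both Pascal rules applied in either order differ only in this middle term,
      whose exponent is \<open>n + 1\<close> on both sides.\<close>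
  have swap: "ipow q k * (ipow q (int (Suc n) - k) * gauss q n (k - 1))
      = ipow q (int (Suc (Suc n)) - k) * (ipow q (k - 1) * gauss q n (k - 1))"
  proof (cases "1 \<le> k \<and> k \<le> int n + 1")
    case True
    then have "ipow q k * ipow q (int (Suc n) - k)
        = ipow q (int (Suc (Suc n)) - k) * ipow q (k - 1)"
      by (simp flip: ipow_add)
    then show ?thesis by (metis mult.assoc)
  next
    case False
    then have "gauss q n (k - 1) = 0" by (intro gauss_outside) auto
    then show ?thesis by simp
  qed
  have "gauss q (Suc (Suc n)) k = gauss q (Suc n) (k - 1) + ipow q k * gauss q (Suc n) k"
    by simp
  also have "\<dots> = ipow q (int (Suc n) - (k - 1)) * gauss q n (k - 1 - 1) + gauss q n (k - 1)
      + ipow q k * (ipow q (int (Suc n) - k) * gauss q n (k - 1) + gauss q n k)"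
    by (simp only: Suc.IH)
  also have "\<dots> = ipow q (int (Suc (Suc n)) - k) * gauss q (Suc n) (k - 1) + gauss q (Suc n) k"
    using swap by (simp add: algebra_simps)
  finally show ?case .
qed

text \<open>Next to a Gaussian binomial powers may be merged even if an exponent is negative, since the
  binomial then vanishes.\<close>
lemma ipow_gauss_low:
  assumes "a \<ge> 0"
  shows "ipow q a * gauss q (Suc n) k
    = ipow q a * gauss q n (k - 1) + ipow q (a + k) * gauss q n k"
proof (cases "k < 0")
  case True
  then show ?thesis by (simp add: gauss_outside)
next
  case False
  then show ?thesis using assms by (simp add: ipow_add algebra_simps)
qed

lemma ipow_gauss_high:
  assumes "a \<ge> 0"
  shows "ipow q a * gauss q (Suc n) k
    = ipow q (a + int (Suc n) - k) * gauss q n (k - 1) + ipow q a * gauss q n k"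
proof (cases "k > int (Suc n)")
  case True
  then show ?thesis by (simp add: gauss_outside)
next
  case False
  then have "ipow q (a + int (Suc n) - k) = ipow q a * ipow q (int (Suc n) - k)"
    using assms ipow_add[of a "int (Suc n) - k" q] by (simp add: algebra_simps)
  then show ?thesis by (simp only: gauss_pascal_dual) (simp add: algebra_simps)
qed

section \<open>Sums over symmetric integer intervals\<close>

lemma sum_symmetric_Suc:
  fixes f :: "int \<Rightarrow> 'a::comm_ring_1"
  shows "(\<Sum>i = - int (Suc L)..int (Suc L). f i)
    = f (- int (Suc L)) + f (int (Suc L)) + (\<Sum>i = - int L..int L. f i)"
proof -
  have "{- int (Suc L)..int (Suc L)} = insert (- int (Suc L)) (insert (int (Suc L)) {- int L..int L})"
    by auto
  then show ?thesis by (simp add: add.assoc)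
qed

lemma sum_symmetric_telescope:
  fixes u :: "int \<Rightarrow> 'a::comm_ring_1"
  shows "(\<Sum>i = - int L..int L. u (i + 1) - u i) = u (int L + 1) - u (- int L)"
proof (induction L)
  case 0
  show ?case by simp
next
  case (Suc L)
  show ?case by (simp only: sum_symmetric_Suc Suc.IH) (simp add: algebra_simps)
qed

lemma sum_symmetric_parity:
  fixes f :: "int \<Rightarrow> 'a::comm_ring_1"
  shows "(\<Sum>j = - int (2 * L + 1)..int (2 * L + 1). f j)
    = (\<Sum>i = - int L..int L. f (2 * i) + f (2 * i + 1)) + f (- int (2 * L + 1))"
proof (induction L)
  case 0
  have "{-1..1::int} = {-1, 0, 1}" by auto
  then show ?case by simp
next
  case (Suc L)
  have e: "2 * Suc L + 1 = Suc (Suc (2 * L + 1))" by simp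
  show ?case
    by (simp only: e sum_symmetric_Suc Suc.IH) (simp add: algebra_simps)
qed

section \<open>Schur's polynomials\<close>

text \<open>The generating polynomial of the partitions with difference at least 2 and parts in
  \<open>{2..n}\<close>: either \<open>n\<close> is absent, or it occurs once and the other parts are at most
  \<open>n - 2\<close>.\<close>
fun schur_poly :: "'a::comm_ring_1 \<Rightarrow> nat \<Rightarrow> 'a" where
  "schur_poly q 0 = 1"
| "schur_poly q (Suc 0) = 1"
| "schur_poly q (Suc (Suc n)) = schur_poly q (Suc n) + q ^ Suc (Suc n) * schur_poly q n"

text \<open>Schur's alternating sum \<open>\<Sum>j. (-1)^j q^(j (5 j - 3) / 2) [N, \<lfloor>(N - 5 j) / 2\<rfloor> + 1]\<close>, with the
  terms \<open>j = 2 i\<close> and \<open>j = 2 i + 1\<close> paired, for odd \<open>N = 2 m + 1\<close> and for even \<open>N = 2 m\<close>;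
  splitting by both parities removes the floor.\<close>
definition alt_odd :: "'a::comm_ring_1 \<Rightarrow> nat \<Rightarrow> int \<Rightarrow> 'a" where
  "alt_odd q m i = ipow q (10*i*i - 3*i) * gauss q (Suc (2*m)) (int m + 1 - 5*i)
     - ipow q (10*i*i + 7*i + 1) * gauss q (Suc (2*m)) (int m - 1 - 5*i)"

definition alt_even :: "'a::comm_ring_1 \<Rightarrow> nat \<Rightarrow> int \<Rightarrow> 'a" where
  "alt_even q m i = ipow q (10*i*i - 3*i) * gauss q (2*m) (int m + 1 - 5*i)
     - ipow q (10*i*i + 7*i + 1) * gauss q (2*m) (int m - 2 - 5*i)"

lemma abs_le_square_int: "\<bar>i\<bar> \<le> i * i" for i :: int
  by (metis abs_ge_zero abs_mult_self_eq linorder_not_less mult_le_cancel_left1 zero_less_abs_iff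
      int_one_le_iff_zero_less mult_eq_0_iff order_refl abs_0 mult.commute)

text \<open>The quadratic exponents that occur: they are nonnegative, and the first two grow at least
  like \<open>\<bar>i\<bar>\<close>, so that only finitely many terms of the theta series matter modulo \<open>q ^ T\<close>.\<close>
lemma quadratic_ge:
  fixes i :: int
  shows "10*i*i - 3*i \<ge> \<bar>i\<bar>" "10*i*i + 7*i + 1 \<ge> \<bar>i\<bar>" "10*i*i + 2*i \<ge> 0"
    "10*i*i - 8*i + 2 \<ge> 0" "10*i*i + 12*i + 4 \<ge> 0"
proof -
  note * = abs_le_square_int
  have p: "(i + 1) * (i + 1) \<ge> 0" by simp
  show "10*i*i - 3*i \<ge> \<bar>i\<bar>" "10*i*i + 2*i \<ge> 0" "10*i*i - 8*i + 2 \<ge> 0"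
    using *[of i] by linarith+
  show "10*i*i + 7*i + 1 \<ge> \<bar>i\<bar>" "10*i*i + 12*i + 4 \<ge> 0"
    using *[of i] *[of "i + 1"] p by (simp_all add: algebra_simps)
qed

text \<open>Schur's recurrence from even to odd upper index holds term by term. One Pascal step on each
  binomial produces two terms with the common exponent \<open>f\<close>; the opposite Pascal steps on these
  leave equal remainders, which cancel.\<close>
lemma alt_odd_rec:
  "alt_odd q (Suc m) i = alt_even q (Suc m) i + q ^ (2 * m + 2) * alt_odd q m i"
proof -
  define M where "M = int m + 1"
  define e1 e2 f where "e1 = 10*i*i - 3*i" and "e2 = 10*i*i + 7*i + 1" and "f = 10*i*i + 2*i + M"
  note defs = M_def e1_def e2_def f_def
  have nn: "e1 \<ge> 0" "e2 \<ge> 0" "f \<ge> 0"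
    using quadratic_ge[of i] unfolding defs by linarith+
  have two: "2 * Suc m = Suc (Suc (2 * m))" by simp
  have "ipow q e1 * gauss q (Suc (2 * Suc m)) (M + 1 - 5*i)
      = ipow q f * gauss q (2 * Suc m) (M - 5*i) + ipow q e1 * gauss q (2 * Suc m) (M + 1 - 5*i)"
    using ipow_gauss_high[OF nn(1), of q "2 * Suc m" "M + 1 - 5*i"]
    by (simp add: defs algebra_simps)
  moreover have "ipow q e2 * gauss q (Suc (2 * Suc m)) (M - 1 - 5*i)
      = ipow q e2 * gauss q (2 * Suc m) (M - 2 - 5*i) + ipow q f * gauss q (2 * Suc m) (M - 1 - 5*i)"
    using ipow_gauss_low[OF nn(2), of q "2 * Suc m" "M - 1 - 5*i"]
    by (simp add: defs algebra_simps)
  moreover have "ipow q f * gauss q (2 * Suc m) (M - 5*i)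
      = ipow q f * gauss q (Suc (2 * m)) (M - 1 - 5*i)
        + ipow q (e1 + int (2 * m + 2)) * gauss q (Suc (2 * m)) (M - 5*i)"
    using ipow_gauss_low[OF nn(3), of q "Suc (2 * m)" "M - 5*i"] unfolding two
    by (simp del: gauss.simps add: defs algebra_simps)
  moreover have "ipow q f * gauss q (2 * Suc m) (M - 1 - 5*i)
      = ipow q (e2 + int (2 * m + 2)) * gauss q (Suc (2 * m)) (M - 2 - 5*i)
        + ipow q f * gauss q (Suc (2 * m)) (M - 1 - 5*i)"
    using ipow_gauss_high[OF nn(3), of q "Suc (2 * m)" "M - 1 - 5*i"] unfolding two
    by (simp del: gauss.simps add: defs algebra_simps)
  moreover have "ipow q (e1 + int (2 * m + 2)) = q ^ (2 * m + 2) * ipow q e1"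
    "ipow q (e2 + int (2 * m + 2)) = q ^ (2 * m + 2) * ipow q e2"
    using nn by (simp_all only: ipow_add ipow_of_nat of_nat_0_le_iff mult.commute)
  moreover have "alt_odd q (Suc m) i = ipow q e1 * gauss q (Suc (2 * Suc m)) (M + 1 - 5*i)
      - ipow q e2 * gauss q (Suc (2 * Suc m)) (M - 1 - 5*i)"
    "alt_even q (Suc m) i = ipow q e1 * gauss q (2 * Suc m) (M + 1 - 5*i)
      - ipow q e2 * gauss q (2 * Suc m) (M - 2 - 5*i)"
    "alt_odd q m i = ipow q e1 * gauss q (Suc (2 * m)) (M - 5*i)
      - ipow q e2 * gauss q (Suc (2 * m)) (M - 2 - 5*i)"
    unfolding alt_odd_def alt_even_def defs by (simp_all del: gauss.simps add: algebra_simps)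
  ultimately show ?thesis by (simp only: right_diff_distrib mult.assoc) (simp only: algebra_simps)
qed

text \<open>From odd to even upper index the cancellation is between neighbouring values of \<open>i\<close>. The
  terms to be moved from \<open>i\<close> to \<open>i + 1\<close> are collected here; they telescope in the sum.\<close>
definition alt_shift :: "'a::comm_ring_1 \<Rightarrow> nat \<Rightarrow> int \<Rightarrow> 'a" where
  "alt_shift q m i = ipow q (10*i*i - 3*i + 2 * int m + 1) * gauss q (2*m) (int m + 1 - 5*i)
    - ipow q (10*i*i - 8*i + int m + 2) * gauss q (Suc (2*m)) (int m + 2 - 5*i)"

lemma alt_even_rec:
  "alt_even q (Suc m) i = alt_odd q m i + q ^ (2 * m + 1) * alt_even q m i
     + (alt_shift q m (i + 1) - alt_shift q m i)"
proof -
  define M where "M = int m"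
  define e1 e2 where "e1 = 10*i*i - 3*i" and "e2 = 10*i*i + 7*i + 1"
  define f g where "f = 10*i*i - 8*i + M + 2" and "g = 10*i*i + 12*i + M + 4"
  note defs = M_def e1_def e2_def f_def g_def
  have nn: "e1 \<ge> 0" "e2 \<ge> 0" "f \<ge> 0" "g \<ge> 0"
    using quadratic_ge[of i] unfolding defs by linarith+
  have two: "2 * Suc m = Suc (Suc (2 * m))" by simp
  have "ipow q e1 * gauss q (2 * Suc m) (M + 2 - 5*i)
      = ipow q e1 * gauss q (Suc (2 * m)) (M + 1 - 5*i) + ipow q f * gauss q (Suc (2 * m)) (M + 2 - 5*i)"
    using ipow_gauss_low[OF nn(1), of q "Suc (2 * m)" "M + 2 - 5*i"] unfolding two
    by (simp del: gauss.simps add: defs algebra_simps)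
  moreover have "ipow q e2 * gauss q (2 * Suc m) (M - 1 - 5*i)
      = ipow q g * gauss q (Suc (2 * m)) (M - 2 - 5*i) + ipow q e2 * gauss q (Suc (2 * m)) (M - 1 - 5*i)"
    using ipow_gauss_high[OF nn(2), of q "Suc (2 * m)" "M - 1 - 5*i"] unfolding two
    by (simp del: gauss.simps add: defs algebra_simps)
  moreover have "ipow q g * gauss q (Suc (2 * m)) (M - 3 - 5*i)
      = ipow q (10*i*i + 17*i + 2 * M + 8) * gauss q (2 * m) (M - 4 - 5*i)
        + ipow q g * gauss q (2 * m) (M - 3 - 5*i)"
    using ipow_gauss_high[OF nn(4), of q "2 * m" "M - 3 - 5*i"]
    by (simp del: gauss.simps add: defs algebra_simps)
  moreover have "ipow q g * gauss q (Suc (2 * m)) (M - 2 - 5*i)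
      = ipow q g * gauss q (2 * m) (M - 3 - 5*i)
        + ipow q (e2 + int (2 * m + 1)) * gauss q (2 * m) (M - 2 - 5*i)"
    using ipow_gauss_low[OF nn(4), of q "2 * m" "M - 2 - 5*i"]
    by (simp del: gauss.simps add: defs algebra_simps)
  moreover have "ipow q (e1 + int (2 * m + 1)) = q ^ (2 * m + 1) * ipow q e1"
    "ipow q (e2 + int (2 * m + 1)) = q ^ (2 * m + 1) * ipow q e2"
    using nn by (simp_all only: ipow_add ipow_of_nat of_nat_0_le_iff mult.commute)
  moreover have "alt_even q (Suc m) i = ipow q e1 * gauss q (2 * Suc m) (M + 2 - 5*i)
      - ipow q e2 * gauss q (2 * Suc m) (M - 1 - 5*i)"
    "alt_odd q m i = ipow q e1 * gauss q (Suc (2 * m)) (M + 1 - 5*i)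
      - ipow q e2 * gauss q (Suc (2 * m)) (M - 1 - 5*i)"
    "alt_even q m i = ipow q e1 * gauss q (2 * m) (M + 1 - 5*i)
      - ipow q e2 * gauss q (2 * m) (M - 2 - 5*i)"
    "alt_shift q m i = ipow q (e1 + int (2 * m + 1)) * gauss q (2 * m) (M + 1 - 5*i)
      - ipow q f * gauss q (Suc (2 * m)) (M + 2 - 5*i)"
    "alt_shift q m (i + 1) = ipow q (10*i*i + 17*i + 2 * M + 8) * gauss q (2 * m) (M - 4 - 5*i)
      - ipow q g * gauss q (Suc (2 * m)) (M - 3 - 5*i)"
    unfolding alt_odd_def alt_even_def alt_shift_def defs
    by (simp_all del: gauss.simps add: algebra_simps)
  ultimately show ?thesis by (simp only: right_diff_distrib mult.assoc) (simp only: algebra_simps)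
qed

text \<open>The bound on \<open>L\<close> makes the summation range contain every nonzero term, so that the boundary
  terms of the telescoping sum vanish.\<close>
lemma schur_poly_eq_alternating_sum:
  assumes "L > m"
  shows "schur_poly q (2 * m) = (\<Sum>i = - int L..int L. alt_odd q m i)"
    and "schur_poly q (2 * m + 1) = (\<Sum>i = - int L..int L. alt_even q (Suc m) i)"
proof -
  have odd_rec: "(\<Sum>i = - int L..int L. alt_odd q (Suc m) i)
      = (\<Sum>i = - int L..int L. alt_even q (Suc m) i)
        + q ^ (2 * m + 2) * (\<Sum>i = - int L..int L. alt_odd q m i)" for m
    by (simp only: alt_odd_rec sum.distrib sum_distrib_left)
  have even_rec: "(\<Sum>i = - int L..int L. alt_even q (Suc m) i)
      = (\<Sum>i = - int L..int L. alt_odd q m i)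
        + q ^ (2 * m + 1) * (\<Sum>i = - int L..int L. alt_even q m i)" if "L > m" for m
  proof -
    have "alt_shift q m (int L + 1) = 0" "alt_shift q m (- int L) = 0"
      using that by (simp_all add: alt_shift_def gauss_outside)
    then show ?thesis
      by (simp only: alt_even_rec sum.distrib sum_distrib_left sum_symmetric_telescope) simp
  qed
  have start: "(\<Sum>i = - int L..int L. alt_odd q 0 i) = 1"
  proof -
    have "alt_odd q 0 i = (if i = 0 then 1 else 0)" for i
    proof -
      have "1 - 5 * i \<noteq> 0" "-1 - 5 * i \<noteq> 0" "-2 - 5 * i \<noteq> 0" by presburger+
      then show ?thesis by (auto simp: alt_odd_def)
    qed
    then show ?thesis by simp
  qed
  \<comment> \<open>The sum for \<open>N = 0\<close> corresponds to the value 0 of the polynomials at index \<open>-1\<close>,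
      which is what the recurrence gives backwards.\<close>
  have start': "(\<Sum>i = - int L..int L. alt_even q 0 i) = 0"
  proof -
    have "alt_even q 0 i = 0" for i
    proof -
      have "1 - 5 * i \<noteq> 0" "-2 - 5 * i \<noteq> 0" by presburger+
      then show ?thesis by (auto simp: alt_even_def)
    qed
    then show ?thesis by simp
  qed
  have "schur_poly q (2 * m) = (\<Sum>i = - int L..int L. alt_odd q m i)
      \<and> schur_poly q (2 * m + 1) = (\<Sum>i = - int L..int L. alt_even q (Suc m) i)"
    using assms
  proof (induction m)
    case 0
    then show ?case using even_rec[of 0] start start' by simp
  next
    case (Suc m)
    then have IH: "schur_poly q (2 * m) = (\<Sum>i = - int L..int L. alt_odd q m i)"
      "schur_poly q (Suc (2 * m)) = (\<Sum>i = - int L..int L. alt_even q (Suc m) i)"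
      by simp_all
    have "schur_poly q (2 * Suc m) = (\<Sum>i = - int L..int L. alt_odd q (Suc m) i)"
      using IH odd_rec[of m] by simp
    moreover from this have "schur_poly q (2 * Suc m + 1) = (\<Sum>i = - int L..int L. alt_even q (Suc (Suc m)) i)"
      using IH even_rec[OF Suc.prems] by simp
    ultimately show ?case by blast
  qed
  then show "schur_poly q (2 * m) = (\<Sum>i = - int L..int L. alt_odd q m i)"
    "schur_poly q (2 * m + 1) = (\<Sum>i = - int L..int L. alt_even q (Suc m) i)"
    by blast+
qed

section \<open>A finite form of Jacobi's triple product\<close>

text \<open>The general term of Ramanujan's theta function \<open>f(x, y)\<close>. Unlike \<open>z^j q^(j\<^sup>2)\<close> it needs no
  inverse of \<open>z\<close>: both exponents are nonnegative for every integer \<open>j\<close>.\<close>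
definition ramanujan :: "'a::comm_ring_1 \<Rightarrow> 'a \<Rightarrow> int \<Rightarrow> 'a" where
  "ramanujan x y j = x ^ nat (j * (j + 1) div 2) * y ^ nat (j * (j - 1) div 2)"

lemma ramanujan_swap: "ramanujan y x (- j) = ramanujan x y j"
  by (simp add: ramanujan_def algebra_simps)

lemma ramanujan_0 [simp]: "ramanujan x y 0 = 1"
  by (simp add: ramanujan_def)

lemma ramanujan_nonneg: "ramanujan x y (int (Suc n)) = x * (x * y) ^ n * ramanujan x y (int n)"
proof -
  have t: "(int k * (int k + 1)) div 2 = int (k * (k + 1) div 2)" for k
    by (simp add: zdiv_int algebra_simps)
  have a: "nat (int n * (int n + 1) div 2) = n * (n + 1) div 2"
    by (subst t) simp
  have b: "nat (int (Suc n) * (int (Suc n) + 1) div 2) = n * (n + 1) div 2 + Suc n"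
    by (subst t) simp
  have c: "nat (int (Suc n) * (int (Suc n) - 1) div 2) = n * (n + 1) div 2"
    using a by (simp add: mult.commute add.commute)
  have d: "n * (n + 1) div 2 = nat (int n * (int n - 1) div 2) + n"
  proof (cases n)
    case (Suc k)
    have "nat (int n * (int n - 1) div 2) = k * (k + 1) div 2"
      using t[of k] Suc by (simp add: mult.commute add.commute)
    then show ?thesis using Suc by simp
  qed simp
  have "y ^ (n * (n + 1) div 2) = y ^ nat (int n * (int n - 1) div 2) * y ^ n"
    by (subst d) (rule power_add)
  then show ?thesis
    unfolding ramanujan_def a b c by (simp only: power_add power_Suc power_mult_distrib ac_simps)
qed

text \<open>Multiplying by the next factor of the triple product moves the term at \<open>j - 1\<close> to the one at
  \<open>j\<close>, and the resulting power of \<open>x * y\<close> is the one demanded by the Pascal rule.\<close>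
lemma ramanujan_shift:
  assumes "j \<le> int a + 1"
  shows "x * (x * y) ^ a * ramanujan x y (j - 1) = ipow (x * y) (int a + 1 - j) * ramanujan x y j"
proof (cases "j \<ge> 1")
  case True
  define n where "n = nat (j - 1)"
  have j: "j = int (Suc n)" and n: "n \<le> a" using True assms by (auto simp: n_def)
  obtain c where c: "a = n + c" using n le_Suc_ex by blast
  have "ramanujan x y j = x * (x * y) ^ n * ramanujan x y (j - 1)"
    unfolding j ramanujan_nonneg by simp
  moreover have "ipow (x * y) (int a + 1 - j) = (x * y) ^ c"
    using ipow_of_nat[of "x * y" c] by (simp add: j c)
  ultimately show ?thesis by (simp add: c power_add mult.assoc mult.left_commute)
next
  case False
  define n where "n = nat (- j)"
  have j: "j = - int n" using False by (simp add: n_def)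
  have "ramanujan x y (j - 1) = ramanujan y x (int (Suc n))"
  proof -
    have "j - 1 = - int (Suc n)" by (simp add: j)
    then show ?thesis by (simp only: ramanujan_swap)
  qed
  also have "\<dots> = y * (x * y) ^ n * ramanujan x y j"
    unfolding ramanujan_nonneg using ramanujan_swap[of y x j] by (simp add: j mult.commute)
  finally have "ramanujan x y (j - 1) = y * (x * y) ^ n * ramanujan x y j" .
  moreover have "ipow (x * y) (int a + 1 - j) = (x * y) ^ Suc (a + n)"
    using ipow_of_nat[of "x * y" "Suc (a + n)"] by (simp add: j algebra_simps)
  ultimately show ?thesis by (simp add: power_add algebra_simps)
qed

lemma sum_symmetric_shift:
  fixes f :: "int \<Rightarrow> 'a::comm_ring_1"
  assumes "f (- int K - 1) = 0" "f (int K) = 0"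
  shows "(\<Sum>j = - int K..int K. f (j - 1)) = (\<Sum>j = - int K..int K. f j)"
proof -
  have "(\<Sum>j = - int K..int K. f j) - (\<Sum>j = - int K..int K. f (j - 1)) = f (int K) - f (- int K - 1)"
    using sum_symmetric_telescope[of "\<lambda>j. f (j - 1)" K] by (simp add: sum_subtractf)
  then show ?thesis using assms by simp
qed

lemma sum_symmetric_reflect:
  fixes f :: "int \<Rightarrow> 'a::comm_ring_1"
  shows "(\<Sum>j = - int K..int K. f (- j)) = (\<Sum>j = - int K..int K. f j)"
  by (rule sum.reindex_bij_witness[of _ uminus uminus]) auto

text \<open>Reflection exchanges the two Pascal rules.\<close>
lemma gauss_symmetric: "gauss q n (int n - k) = gauss q n k"
proof (induction n arbitrary: k)
  case (Suc n)
  have "gauss q (Suc n) (int (Suc n) - k)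
      = ipow q k * gauss q n (int n - k) + gauss q n (int n - (k - 1))"
    by (subst gauss_pascal_dual) (simp add: algebra_simps)
  then show ?case by (simp add: Suc.IH)
qed auto

lemma jtp_extend_left:
  fixes x y :: "'a::comm_ring_1"
  assumes "a + b < K"
  shows "(1 + x * (x * y) ^ a)
      * (\<Sum>j = - int K..int K. ramanujan x y j * gauss (x * y) (a + b) (int b + j))
    = (\<Sum>j = - int K..int K. ramanujan x y j * gauss (x * y) (Suc (a + b)) (int b + j))"
proof -
  define f where "f j = x * (x * y) ^ a * (ramanujan x y j * gauss (x * y) (a + b) (int b + j))" for j
  have "f (- int K - 1) = 0" "f (int K) = 0"
    using assms by (simp_all add: f_def gauss_outside)
  then have shift: "(\<Sum>j = - int K..int K. f j) = (\<Sum>j = - int K..int K. f (j - 1))"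
    by (simp only: sum_symmetric_shift)
  have step: "f (j - 1) + ramanujan x y j * gauss (x * y) (a + b) (int b + j)
      = ramanujan x y j * gauss (x * y) (Suc (a + b)) (int b + j)" for j
  proof (cases "j \<le> int a + 1")
    case True
    have e: "int (Suc (a + b)) - (int b + j) = int a + 1 - j" by simp
    show ?thesis
      unfolding gauss_pascal_dual e f_def mult.assoc[symmetric] ramanujan_shift[OF True]
      by (simp add: algebra_simps)
  next
    case False
    then show ?thesis by (simp add: f_def gauss_outside del: gauss.simps)
  qed
  have "(1 + x * (x * y) ^ a)
      * (\<Sum>j = - int K..int K. ramanujan x y j * gauss (x * y) (a + b) (int b + j))
    = (\<Sum>j = - int K..int K. f j)
      + (\<Sum>j = - int K..int K. ramanujan x y j * gauss (x * y) (a + b) (int b + j))"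
    by (simp only: f_def distrib_right sum_distrib_left sum.distrib mult_1 add.commute)
  also have "\<dots> = (\<Sum>j = - int K..int K. ramanujan x y j * gauss (x * y) (Suc (a + b)) (int b + j))"
    unfolding shift sum.distrib[symmetric] step ..
  finally show ?thesis .
qed

text \<open>The substitution of \<open>- j\<close> for \<open>j\<close> exchanges the roles of the two products, so that it suffices
  to extend one of them.\<close>
lemma jtp_sum_swap:
  "(\<Sum>j = - int K..int K. ramanujan y x j * gauss (y * x) (a + b) (int a + j))
    = (\<Sum>j = - int K..int K. ramanujan x y j * gauss (x * y) (a + b) (int b + j))"
proof -
  have "ramanujan y x (- j) * gauss (y * x) (a + b) (int a + - j)
      = ramanujan x y j * gauss (x * y) (a + b) (int b + j)" for j
    using gauss_symmetric[of "x * y" "a + b" "int b + j"]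
    by (simp add: ramanujan_swap mult.commute algebra_simps)
  then show ?thesis
    using sum_symmetric_reflect[of "\<lambda>j. ramanujan y x j * gauss (y * x) (a + b) (int a + j)" K]
    by simp
qed

lemma jtp_finite_left:
  fixes x y :: "'a::comm_ring_1"
  assumes "a + b \<le> K"
  shows "(\<Prod>i<a. 1 + x * (x * y) ^ i)
      * (\<Sum>j = - int K..int K. ramanujan x y j * gauss (x * y) b (int b + j))
    = (\<Sum>j = - int K..int K. ramanujan x y j * gauss (x * y) (a + b) (int b + j))"
  using assms
proof (induction a)
  case (Suc a)
  then show ?case
    using jtp_extend_left[of a b K x y] by (simp add: ac_simps del: gauss.simps)
qed simp

theorem jacobi_triple_product_finite:
  fixes x y :: "'a::comm_ring_1"
  assumes "a + b \<le> K"
  shows "(\<Prod>i<a. 1 + x * (x * y) ^ i) * (\<Prod>i<b. 1 + y * (x * y) ^ i)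
    = (\<Sum>j = - int K..int K. ramanujan x y j * gauss (x * y) (a + b) (int b + j))"
proof -
  have "(\<Sum>j = - int K..int K. ramanujan y x j * gauss (y * x) 0 (int 0 + j)) = 1"
  proof -
    have "ramanujan y x j * gauss (y * x) 0 (int 0 + j) = (if j = 0 then 1 else 0)" for j
      by simp
    then show ?thesis by (simp only:) simp
  qed
  then have "(\<Prod>i<b. 1 + y * (x * y) ^ i)
      = (\<Sum>j = - int K..int K. ramanujan x y j * gauss (x * y) b (int b + j))"
    using jtp_finite_left[of b 0 K y x] jtp_sum_swap[of y x 0 b K] assms
    by (simp add: mult.commute)
  then show ?thesis using jtp_finite_left[OF assms] by simp
qed

section \<open>Limits as congruences\<close>

definition qpoch :: "'a::comm_ring_1 \<Rightarrow> nat \<Rightarrow> 'a" where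
  "qpoch q n = (\<Prod>i<n. 1 - q ^ Suc i)"

lemma qpoch_simps [simp]: "qpoch q 0 = 1" "qpoch q (Suc n) = qpoch q n * (1 - q ^ Suc n)"
  by (simp_all add: qpoch_def)

text \<open>The first Pascal rule minus \<open>q ^ Suc k\<close> times the second.\<close>
lemma gauss_absorb:
  "(1 - q ^ Suc k) * gauss q (Suc n) (int (Suc k)) = (1 - q ^ Suc n) * gauss q n (int k)"
proof -
  have e: "ipow q (int (Suc k)) = q ^ Suc k"  "int (Suc k) - 1 = int k"
    by (rule ipow_of_nat, simp)
  have low: "gauss q (Suc n) (int (Suc k)) = gauss q n (int k) + q ^ Suc k * gauss q n (int (Suc k))"
    by (simp only: gauss.simps e)
  have "q ^ Suc k * gauss q (Suc n) (int (Suc k))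
      = q ^ Suc n * gauss q n (int k) + q ^ Suc k * gauss q n (int (Suc k))"
  proof -
    have "int (Suc k) + int (Suc n) - int (Suc k) = int (Suc n)" by simp
    then show ?thesis
      using ipow_gauss_high[of "int (Suc k)" q n "int (Suc k)"] by (simp only: e ipow_of_nat)
  qed
  then show ?thesis by (simp only: left_diff_distrib low) (simp add: algebra_simps)
qed

lemma gauss_qpoch: "qpoch q k * gauss q (k + l) (int k) * qpoch q l = qpoch q (k + l)"
proof (induction k)
  case 0
  have "gauss q l 0 = 1"
    by (induction l) (simp_all add: gauss_outside)
  then show ?case by simp
next
  case (Suc k)
  have "qpoch q (Suc k) * gauss q (Suc k + l) (int (Suc k)) * qpoch q l
      = qpoch q k * qpoch q l * ((1 - q ^ Suc k) * gauss q (Suc (k + l)) (int (Suc k)))"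
    by (simp only: qpoch_simps add_Suc mult.assoc mult.commute mult.left_commute)
  also have "\<dots> = (qpoch q k * gauss q (k + l) (int k) * qpoch q l) * (1 - q ^ Suc (k + l))"
    by (simp only: gauss_absorb ac_simps)
  finally show ?case by (simp only: Suc.IH qpoch_simps add_Suc)
qed

lemma dvd_diff_mult:
  fixes d :: "'a::comm_ring_1"
  assumes "d dvd a - b" "d dvd e - f"
  shows "d dvd a * e - b * f"
proof -
  have "a * e - b * f = (a - b) * e + b * (e - f)" by (simp add: algebra_simps)
  then show ?thesis using assms by simp
qed

lemma dvd_diff_sym:
  fixes d :: "'a::comm_ring_1"
  shows "d dvd a - b \<Longrightarrow> d dvd b - a"
  by (metis dvd_minus_iff minus_diff_eq)

lemma dvd_diff_trans:
  fixes d :: "'a::comm_ring_1"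
  assumes "d dvd a - b" "d dvd b - c"
  shows "d dvd a - c"
  using dvd_add[OF assms] by simp

text \<open>Being congruent to 1 modulo \<open>p\<close>, \<open>c\<close> is a unit modulo \<open>p ^ T\<close>: it divides
  \<open>1 - (1 - c) ^ T\<close>, which is congruent to 1 modulo \<open>p ^ T\<close>.\<close>
lemma dvd_cancel_near_one:
  fixes p c z :: "'a::comm_ring_1"
  assumes "p dvd 1 - c" "p ^ T dvd c * z"
  shows "p ^ T dvd z"
proof -
  have "c dvd 1 - (1 - c) ^ T"
  proof -
    have "1 - (1 - c) dvd 1 ^ T - (1 - c) ^ T"
      by (metis dvd_triv_left power_diff_sumr2)
    then show ?thesis by simp
  qed
  then obtain r where "1 - (1 - c) ^ T = c * r" ..
  then have "z = r * (c * z) + (1 - c) ^ T * z"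
    by (metis (no_types, opaque_lifting) add.commute diff_add_cancel mult.assoc mult.commute
        distrib_right mult_1)
  moreover have "p ^ T dvd (1 - c) ^ T * z"
    using assms(1) by (simp add: dvd_power_same)
  ultimately show ?thesis
    using assms(2) by (metis dvd_add dvd_mult)
qed

lemma qpoch_near_one:
  fixes p q :: "'a::comm_ring_1"
  assumes "p dvd q"
  shows "p dvd 1 - qpoch q n"
proof (induction n)
  case (Suc n)
  have "p dvd 1 * 1 - qpoch q n * (1 - q ^ Suc n)"
    using assms by (intro dvd_diff_mult Suc) simp
  then show ?case by simp
qed simp

lemma qpoch_stable:
  fixes p q :: "'a::comm_ring_1"
  assumes "p dvd q" "T \<le> n"
  shows "p ^ T dvd qpoch q n - qpoch q T"
  using assms(2)
proof (induction n rule: dec_induct)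
  case (step n)
  have "p ^ T dvd q ^ Suc n"
    using assms(1) step.hyps by (meson dvd_power_same le_imp_power_dvd le_SucI dvd_trans)
  then have "p ^ T dvd qpoch q n * (1 - q ^ Suc n) - qpoch q T * 1"
    by (intro dvd_diff_mult step.IH) simp
  then show ?case by simp
qed simp

text \<open>Modulo \<open>p ^ T\<close> all \<open>qpoch q j\<close> with \<open>j \<ge> T\<close> agree, so the quotient formula for the
  Gaussian binomial becomes \<open>u * gauss q n k * u = u\<close> with a unit \<open>u\<close>.\<close>
lemma qpoch_gauss_limit:
  fixes p q :: "'a::comm_ring_1"
  assumes "p dvd q" "int T \<le> k" "k + int T \<le> int n" "T \<le> M"
  shows "p ^ T dvd qpoch q M * gauss q n k - 1"
proof -
  define a b where "a = nat k" and "b = nat (int n - k)"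
  have ab: "k = int a" "n = a + b" "T \<le> a" "T \<le> b"
    using assms by (auto simp: a_def b_def)
  let ?u = "qpoch q T"
  have near: "p ^ T dvd ?u - qpoch q j" if "T \<le> j" for j
    using qpoch_stable[OF assms(1) that] by (rule dvd_diff_sym)
  have "p ^ T dvd ?u * gauss q n k * ?u - qpoch q a * gauss q n k * qpoch q b"
    by (intro dvd_diff_mult near ab(3,4)) simp
  also have "qpoch q a * gauss q n k * qpoch q b = qpoch q n"
    unfolding ab by (rule gauss_qpoch)
  finally have "p ^ T dvd ?u * gauss q n k * ?u - qpoch q n" .
  moreover have "p ^ T dvd qpoch q n - ?u"
    using ab by (intro qpoch_stable assms) simp
  ultimately have "p ^ T dvd ?u * gauss q n k * ?u - ?u"
    by (rule dvd_diff_trans)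
  then have "p ^ T dvd ?u * (?u * gauss q n k - 1)"
    by (simp add: algebra_simps)
  then have "p ^ T dvd ?u * gauss q n k - 1"
    by (rule dvd_cancel_near_one[OF qpoch_near_one[OF assms(1)]])
  moreover have "p ^ T dvd qpoch q M * gauss q n k - ?u * gauss q n k"
    using qpoch_stable[OF assms(1,4)] by (intro dvd_diff_mult) auto
  ultimately show ?thesis using dvd_diff_trans by blast
qed

section \<open>The theta series as a common limit\<close>

text \<open>A truncation of \<open>\<Sum>j. (-1)^j q^(j (5 j - 3) / 2)\<close>, with even and odd \<open>j\<close> paired as in Schur's
  sum.\<close>
definition theta :: "'a::comm_ring_1 \<Rightarrow> nat \<Rightarrow> 'a" where
  "theta q L = (\<Sum>i = - int L..int L. ipow q (10*i*i - 3*i) - ipow q (10*i*i + 7*i + 1))"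

lemma ipow_dvd: "int T \<le> e \<Longrightarrow> q ^ T dvd ipow q e"
  by (auto simp: ipow_def intro!: le_imp_power_dvd)

text \<open>A term whose exponent is at least \<open>T\<close> vanishes modulo \<open>q ^ T\<close>; for the others \<open>\<bar>i\<bar> < T\<close>, and
  since \<open>m\<close> is large the binomial is central enough to be replaced by 1.\<close>
lemma schur_poly_limit:
  fixes q :: "'a::comm_ring_1"
  assumes "T \<le> M" "6 * T + 1 \<le> m" "m < L"
  shows "q ^ T dvd qpoch q M * schur_poly q (2 * m) - theta q L"
proof -
  have term_limit: "q ^ T dvd qpoch q M * (ipow q e * gauss q (Suc (2 * m)) (int m + c - 5 * i)) - ipow q e"
    if "\<bar>i\<bar> \<le> e" "c = 1 \<or> c = -1" for e i c
  proof (cases "int T \<le> e")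
    case True
    then show ?thesis by (intro dvd_diff dvd_mult dvd_mult2 ipow_dvd)
  next
    case False
    then have "q ^ T dvd qpoch q M * gauss q (Suc (2 * m)) (int m + c - 5 * i) - 1"
      using that assms by (intro qpoch_gauss_limit) auto
    then have "q ^ T dvd ipow q e * (qpoch q M * gauss q (Suc (2 * m)) (int m + c - 5 * i) - 1)"
      by (rule dvd_mult)
    then show ?thesis by (simp add: algebra_simps del: gauss.simps)
  qed
  have "q ^ T dvd qpoch q M * alt_odd q m i
      - (ipow q (10*i*i - 3*i) - ipow q (10*i*i + 7*i + 1))" for i
    using dvd_diff[OF term_limit[of i "10*i*i - 3*i" 1] term_limit[of i "10*i*i + 7*i + 1" "-1"]]
      quadratic_ge[of i]
    by (simp add: alt_odd_def algebra_simps del: gauss.simps)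
  then have "q ^ T dvd (\<Sum>i = - int L..int L. qpoch q M * alt_odd q m i
      - (ipow q (10*i*i - 3*i) - ipow q (10*i*i + 7*i + 1)))"
    by (intro dvd_sum)
  then show ?thesis
    unfolding theta_def schur_poly_eq_alternating_sum(1)[OF assms(3)] by (simp only: sum_subtractf sum_distrib_left)
qed

text \<open>The two exponents sum to \<open>j\<^sup>2\<close>, which decides the sign.\<close>
lemma ramanujan_neg:
  "ramanujan (- q) (- (q ^ 4)) j = (if even j then 1 else - 1) * ipow q ((5*j*j - 3*j) div 2)"
proof -
  define a b where "a = nat (j * (j + 1) div 2)" and "b = nat (j * (j - 1) div 2)"
  have nonneg: "j * (j + 1) \<ge> 0" "j * (j - 1) \<ge> 0"
    by (auto simp: zero_le_mult_iff)
  have "even (j * (j + 1))" "even (j * (j - 1))" by auto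
  then have ab: "2 * int a = j * (j + 1)" "2 * int b = j * (j - 1)"
    using nonneg by (simp_all add: a_def b_def)
  have "int (a + b) = j * j" using ab by (simp add: algebra_simps)
  then have parity: "even (a + b) \<longleftrightarrow> even j" by (metis even_mult_iff even_of_nat)
  have "(5*j*j - 3*j) div 2 = int (a + 4 * b)"
  proof -
    have "5*j*j - 3*j = 2 * int (a + 4 * b)" using ab by (simp add: algebra_simps)
    then show ?thesis by simp
  qed
  then have "ipow q ((5*j*j - 3*j) div 2) = q ^ (a + 4 * b)" by (simp only: ipow_of_nat)
  moreover have "q ^ (a + 4 * b) = q ^ a * (q ^ 4) ^ b"
    by (simp only: power_add power_mult)
  moreover have "ramanujan (- q) (- (q ^ 4)) j = (- 1) ^ (a + b) * (q ^ a * (q ^ 4) ^ b)"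
    unfolding ramanujan_def a_def[symmetric] b_def[symmetric] power_minus[of q] power_minus[of "q ^ 4"]
    by (simp only: power_add ac_simps)
  ultimately show ?thesis using parity by (simp add: minus_one_power_iff)
qed

lemma ramanujan_even:
  "ramanujan (- q) (- (q ^ 4)) (2 * i) = ipow q (10*i*i - 3*i)"
proof -
  have "5 * (2*i) * (2*i) - 3 * (2*i) = 2 * (10*i*i - 3*i)" by simp
  then have "(5 * (2*i) * (2*i) - 3 * (2*i)) div 2 = 10*i*i - 3*i" by simp
  then show ?thesis by (simp only: ramanujan_neg) simp
qed

lemma ramanujan_odd:
  "ramanujan (- q) (- (q ^ 4)) (2 * i + 1) = - ipow q (10*i*i + 7*i + 1)"
proof -
  have "5 * (2*i + 1) * (2*i + 1) - 3 * (2*i + 1) = 2 * (10*i*i + 7*i + 1)"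
    by (simp add: algebra_simps)
  then have "(5 * (2*i + 1) * (2*i + 1) - 3 * (2*i + 1)) div 2 = 10*i*i + 7*i + 1" by simp
  then show ?thesis by (simp only: ramanujan_neg) simp
qed

lemma ramanujan_dvd:
  assumes "int T \<le> \<bar>j\<bar>"
  shows "q ^ T dvd ramanujan (- q) (- (q ^ 4)) j"
proof -
  have "\<bar>j\<bar> \<le> j * j"
    by (rule abs_le_square_int)
  then have "int T \<le> (5*j*j - 3*j) div 2" using assms by linarith
  then show ?thesis unfolding ramanujan_neg by (intro dvd_mult ipow_dvd)
qed

text \<open>The triple product at \<open>x = - q\<close>, \<open>y = - (q ^ 4)\<close>, whose base \<open>x * y\<close> is \<open>q ^ 5\<close>.\<close>
lemma product_limit:
  fixes q :: "'a::comm_ring_1"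
  assumes "2 * T \<le> m" "m \<le> L"
  shows "q ^ T dvd qpoch (q ^ 5) m * (\<Prod>i<m. (1 - q ^ (5 * i + 1)) * (1 - q ^ (5 * i + 4))) - theta q L"
proof (cases "T = 0")
  case False
  let ?r = "ramanujan (- q) (- (q ^ 4))"
  \<comment> \<open>Pairing \<open>2 i\<close> with \<open>2 i + 1\<close> for \<open>\<bar>i\<bar> \<le> L\<close> misses only the lower end
      point \<open>- K\<close> of the symmetric range, and that term vanishes modulo \<open>q ^ T\<close>.\<close>
  define K where "K = 2 * L + 1"
  have Q: "(- q) * (- (q ^ 4)) = q ^ 5" by (simp flip: power_Suc)
  have "1 + - q * (q ^ 5) ^ i = 1 - q ^ (5 * i + 1)"
    "1 + - (q ^ 4) * (q ^ 5) ^ i = 1 - q ^ (5 * i + 4)" for i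
    by (simp_all add: power_add mult.commute flip: power_mult)
  then have jtp: "(\<Prod>i<m. (1 - q ^ (5 * i + 1)) * (1 - q ^ (5 * i + 4)))
      = (\<Sum>j = - int K..int K. ?r j * gauss (q ^ 5) (m + m) (int m + j))"
    using jacobi_triple_product_finite[of m m K "- q" "- (q ^ 4)"] assms
    unfolding Q by (simp only: prod.distrib K_def)
  have "q ^ T dvd qpoch (q ^ 5) m * (?r j * gauss (q ^ 5) (m + m) (int m + j)) - ?r j" for j
  proof (cases "int T \<le> \<bar>j\<bar>")
    case True
    then show ?thesis by (intro dvd_diff dvd_mult dvd_mult2 ramanujan_dvd)
  next
    case False
    then have "q ^ T dvd qpoch (q ^ 5) m * gauss (q ^ 5) (m + m) (int m + j) - 1"
      using assms by (intro qpoch_gauss_limit) auto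
    then have "q ^ T dvd ?r j * (qpoch (q ^ 5) m * gauss (q ^ 5) (m + m) (int m + j) - 1)"
      by (rule dvd_mult)
    then show ?thesis by (simp add: algebra_simps)
  qed
  then have "q ^ T dvd (\<Sum>j = - int K..int K.
      qpoch (q ^ 5) m * (?r j * gauss (q ^ 5) (m + m) (int m + j)) - ?r j)"
    by (intro dvd_sum)
  then have "q ^ T dvd qpoch (q ^ 5) m * (\<Prod>i<m. (1 - q ^ (5 * i + 1)) * (1 - q ^ (5 * i + 4)))
      - (\<Sum>j = - int K..int K. ?r j)"
    unfolding jtp by (simp only: sum_subtractf sum_distrib_left)
  moreover have "q ^ T dvd (\<Sum>j = - int K..int K. ?r j) - theta q L"
  proof -
    have "(\<Sum>j = - int K..int K. ?r j) - theta q L = ?r (- int K)"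
      unfolding K_def theta_def sum_symmetric_parity ramanujan_even ramanujan_odd by simp
    moreover have "q ^ T dvd ?r (- int K)"
      using assms by (intro ramanujan_dvd) (simp add: K_def)
    ultimately show ?thesis by simp
  qed
  ultimately show ?thesis by (rule dvd_diff_trans)
qed simp

lemma qpoch_split5:
  "qpoch q (5 * m) = qpoch (q ^ 5) m * (\<Prod>i<m. (1 - q ^ (5 * i + 1)) * (1 - q ^ (5 * i + 4)))
     * (\<Prod>i<m. (1 - q ^ (5 * i + 2)) * (1 - q ^ (5 * i + 3)))"
proof (induction m)
  case (Suc m)
  have "qpoch q (5 * Suc m) = qpoch q (5 * m) * ((1 - q ^ (5 * m + 1)) * (1 - q ^ (5 * m + 2))
      * (1 - q ^ (5 * m + 3)) * (1 - q ^ (5 * m + 4)) * (1 - q ^ (5 * m + 5)))"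
  proof -
    have "5 * Suc m = Suc (Suc (Suc (Suc (Suc (5 * m)))))" by simp
    then show ?thesis by (simp only: qpoch_simps) (simp add: mult.assoc eval_nat_numeral)
  qed
  moreover have "(q ^ 5) ^ Suc m = q ^ (5 * m + 5)"
    by (metis power_mult mult_Suc_right add.commute)
  ultimately show ?case
    using Suc.IH
    by (simp only: qpoch_simps prod.lessThan_Suc mult.assoc mult.commute mult.left_commute)
qed simp

text \<open>Schur's sum and the triple product have the same limit, so the Schur polynomial approaches
  the inverse of the factors with exponents congruent to 2 and 3 modulo 5.\<close>
lemma schur_poly_product_limit:
  fixes q A :: "'a::comm_ring_1"
  assumes "6 * T + 1 \<le> m" and "A * (\<Prod>i<m. (1 - q ^ (5 * i + 2)) * (1 - q ^ (5 * i + 3))) = 1"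
  shows "q ^ T dvd schur_poly q (2 * m) - A"
proof -
  let ?U = "qpoch q (5 * m)"
  let ?R = "qpoch (q ^ 5) m * (\<Prod>i<m. (1 - q ^ (5 * i + 1)) * (1 - q ^ (5 * i + 4)))"
  have "q ^ T dvd ?U * schur_poly q (2 * m) - theta q (Suc m)"
    using assms(1) by (intro schur_poly_limit) auto
  moreover have "q ^ T dvd theta q (Suc m) - ?R"
    by (rule dvd_diff_sym, rule product_limit) (use assms(1) in auto)
  ultimately have "q ^ T dvd ?U * schur_poly q (2 * m) - ?R"
    by (rule dvd_diff_trans)
  moreover have "?R = ?U * A"
    unfolding qpoch_split5[of q m] mult.assoc[of ?R] using assms(2) by (simp add: mult.commute)
  ultimately have "q ^ T dvd ?U * (schur_poly q (2 * m) - A)"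
    by (simp only: right_diff_distrib)
  then show ?thesis
    by (rule dvd_cancel_near_one[OF qpoch_near_one[OF dvd_refl]])
qed

section \<open>Partitions with restricted parts\<close>

text \<open>Multisets represent partitions here because adding and deleting copies of a part is then
  independent of the order of the parts.\<close>
definition partitions_into :: "nat set \<Rightarrow> nat \<Rightarrow> nat multiset set" where
  "partitions_into S t = {A. set_mset A \<subseteq> S \<and> sum_mset A = t}"

lemma finite_partitions_into:
  assumes "0 \<notin> S"
  shows "finite (partitions_into S t)"
proof -
  have size: "size A \<le> sum_mset A" if "0 \<notin># A" for A :: "nat multiset"
    using that by (induction A) auto
  have "partitions_into S t \<subseteq> mset ` {xs. set xs \<subseteq> {..t} \<and> length xs \<le> t}"
  proof
    fix A assume A: "A \<in> partitions_into S t"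
    obtain xs where xs: "mset xs = A" using ex_mset by blast
    have "0 \<notin># A" using A assms by (auto simp: partitions_into_def)
    then have "length xs \<le> t"
      using size[of A] A xs by (auto simp: partitions_into_def)
    moreover have "sum_list xs = t"
      using A xs by (auto simp: partitions_into_def sum_mset_sum_list)
    then have "set xs \<subseteq> {..t}"
      using member_le_sum_list by auto
    ultimately show "A \<in> mset ` {xs. set xs \<subseteq> {..t} \<and> length xs \<le> t}"
      using xs by blast
  qed
  then show ?thesis
    by (rule finite_subset) (simp add: finite_lists_length_le)
qed

lemma card_partitions_into_count_ge:
  assumes "M \<in> S"
  shows "card {A \<in> partitions_into S n. c \<le> count A M} = (if c * M \<le> n then card (partitions_into S (n - c * M)) else 0)"
proof -
  let ?f = "\<lambda>A. A + replicate_mset c M"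
  have image: "{A \<in> partitions_into S n. c \<le> count A M} = ?f ` {A. set_mset A \<subseteq> S \<and> sum_mset A + c * M = n}"
  proof (intro equalityI subsetI)
    fix A assume "A \<in> {A \<in> partitions_into S n. c \<le> count A M}"
    moreover from this have "replicate_mset c M \<subseteq># A"
      by (simp add: count_le_replicate_mset_subset_eq)
    then obtain B where "A = replicate_mset c M + B" by (metis subset_mset.le_iff_add)
    ultimately show "A \<in> ?f ` {A. set_mset A \<subseteq> S \<and> sum_mset A + c * M = n}"
      by (auto simp: partitions_into_def image_iff add.commute sum_mset_replicate_mset intro!: exI[of _ B])
  next
    fix A assume "A \<in> ?f ` {A. set_mset A \<subseteq> S \<and> sum_mset A + c * M = n}"
    then show "A \<in> {A \<in> partitions_into S n. c \<le> count A M}"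
      using assms by (auto simp: partitions_into_def sum_mset_replicate_mset split: if_splits)
  qed
  have "card {A \<in> partitions_into S n. c \<le> count A M} = card {A. set_mset A \<subseteq> S \<and> sum_mset A + c * M = n}"
    unfolding image by (rule card_image) (simp add: inj_on_def)
  also have "{A. set_mset A \<subseteq> S \<and> sum_mset A + c * M = n} = (if c * M \<le> n then partitions_into S (n - c * M) else {})"
    by (auto simp: partitions_into_def)
  finally show ?thesis by simp
qed

definition partitions_gf :: "nat set \<Rightarrow> int fps" where
  "partitions_gf S = Abs_fps (\<lambda>t. int (card (partitions_into S t)))"

text \<open>The partitions that use \<open>N\<close> are those obtained from a partition of \<open>t - N\<close> by adding
  a part \<open>N\<close>.\<close>
lemma partitions_gf_insert:
  assumes "N \<notin> T" "0 \<notin> insert N T"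
  shows "partitions_gf (insert N T) * (1 - fps_X ^ N) = partitions_gf T"
proof (rule fps_ext)
  fix t
  let ?S = "insert N T"
  have "partitions_into ?S t = partitions_into T t \<union> {A \<in> partitions_into ?S t. 1 \<le> count A N}"
    using assms by (auto simp: partitions_into_def)
  moreover have "partitions_into T t \<inter> {A \<in> partitions_into ?S t. 1 \<le> count A N} = {}"
    using assms by (auto simp: partitions_into_def)
  ultimately have "card (partitions_into ?S t) = card (partitions_into T t) + card {A \<in> partitions_into ?S t. 1 \<le> count A N}"
    using finite_partitions_into[of T t] finite_partitions_into[of ?S t] assms
    by (metis (no_types, lifting) card_Un_disjoint finite_Un insertCI)
  also have "card {A \<in> partitions_into ?S t. 1 \<le> count A N} = (if N \<le> t then card (partitions_into ?S (t - N)) else 0)"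
    by (subst card_partitions_into_count_ge) simp_all
  finally show "fps_nth (partitions_gf ?S * (1 - fps_X ^ N)) t = fps_nth (partitions_gf T) t"
    by (simp add: partitions_gf_def right_diff_distrib fps_X_power_mult_right_nth)
qed

lemma partitions_gf_product:
  assumes "finite S" "0 \<notin> S"
  shows "partitions_gf S * (\<Prod>s\<in>S. 1 - fps_X ^ s) = 1"
  using assms
proof (induction S)
  case empty
  have "partitions_into {} t = (if t = 0 then {{#}} else {})" for t
    by (auto simp: partitions_into_def)
  then show ?case by (simp add: partitions_gf_def fps_eq_iff)
next
  case (insert N T)
  have "partitions_gf (insert N T) * (\<Prod>s\<in>insert N T. 1 - fps_X ^ s)
      = partitions_gf (insert N T) * (1 - fps_X ^ N) * (\<Prod>s\<in>T. 1 - fps_X ^ s)"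
    using insert.hyps by (simp only: prod.insert mult.assoc) simp
  also have "\<dots> = 1"
    unfolding partitions_gf_insert[OF insert.hyps(2) insert.prems] using insert.prems by (intro insert.IH) auto
  finally show ?case .
qed

definition two_three_mod_five :: "nat set" where
  "two_three_mod_five = {i. i mod 5 = 2 \<or> i mod 5 = 3}"

lemma prod_two_three_mod_five:
  "(\<Prod>s \<in> {s \<in> two_three_mod_five. s < 5 * m}. f s) = (\<Prod>i<m. f (5 * i + 2) * f (5 * i + 3 :: nat))"
  for f :: "nat \<Rightarrow> 'a::comm_monoid_mult"
proof (induction m)
  case (Suc m)
  define P where "P m = {s \<in> two_three_mod_five. s < 5 * m}" for m
  have fin: "finite (P m)"
    by (rule finite_subset[of _ "{..<5 * m}"]) (auto simp: P_def)
  have key: "s mod 5 = 2 \<or> s mod 5 = 3 \<longleftrightarrow> s = 5 * m + 2 \<or> s = 5 * m + 3"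
    if "5 * m \<le> s" "s < 5 * m + 5" for s :: nat
    using that by presburger
  have "s \<in> P (Suc m) \<longleftrightarrow> s \<in> insert (5 * m + 2) (insert (5 * m + 3) (P m))" for s
  proof (cases "s < 5 * m")
    case True
    then show ?thesis by (simp add: P_def)
  next
    case False
    then show ?thesis using key[of s] by (auto simp: P_def two_three_mod_five_def)
  qed
  then have "P (Suc m) = insert (5 * m + 2) (insert (5 * m + 3) (P m))"
    by (rule set_eqI)
  moreover have "5 * m + 2 \<notin> insert (5 * m + 3) (P m)" "5 * m + 3 \<notin> P m"
    by (simp_all add: P_def)
  ultimately show ?case
    using Suc fin unfolding P_def[symmetric] by (simp add: mult_ac)
qed simp

section \<open>The second Rogers-Ramanujan identity\<close>

definition spaced :: "nat \<Rightarrow> nat list set" where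
  "spaced t = {xs. sorted_wrt (\<lambda>x y. y + 2 \<le> x) xs \<and> (\<forall>x \<in> set xs. 2 \<le> x) \<and> sum_list xs = t}"

definition spaced_upto :: "nat \<Rightarrow> nat \<Rightarrow> nat list set" where
  "spaced_upto N t = {xs \<in> spaced t. \<forall>x \<in> set xs. x \<le> N}"

lemma spaced_upto_eq_spaced:
  assumes "t \<le> N"
  shows "spaced_upto N t = spaced t"
proof -
  have "x \<le> N" if "xs \<in> spaced t" "x \<in> set xs" for xs x
    using that assms member_le_sum_list[of x xs] by (simp add: spaced_def)
  then show ?thesis by (auto simp: spaced_upto_def)
qed

lemma spaced_upto_small:
  assumes "N < 2"
  shows "spaced_upto N t = (if t = 0 then {[]} else {})"
proof -
  have "xs \<in> spaced_upto N t \<longleftrightarrow> xs = [] \<and> t = 0" for xs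
    using assms by (cases xs) (auto simp: spaced_upto_def spaced_def)
  then show ?thesis by auto
qed

lemma spaced_upto_rec:
  "spaced_upto (Suc (Suc N)) t = spaced_upto (Suc N) t
     \<union> (#) (Suc (Suc N)) ` (if Suc (Suc N) \<le> t then spaced_upto N (t - Suc (Suc N)) else {})"
    (is "_ = _ \<union> ?B")
proof (intro equalityI subsetI)
  fix xs assume xs: "xs \<in> spaced_upto (Suc (Suc N)) t"
  show "xs \<in> spaced_upto (Suc N) t \<union> ?B"
  proof (cases "Suc (Suc N) \<in> set xs")
    case True
    then obtain x ys where "xs = x # ys" by (cases xs) auto
    moreover from this have "x = Suc (Suc N)"
      using xs True by (auto simp: spaced_upto_def spaced_def)
    ultimately show ?thesis
      using xs by (auto simp: spaced_upto_def spaced_def)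
  next
    case False
    then show ?thesis using xs by (auto simp: spaced_upto_def le_Suc_eq)
  qed
next
  fix xs assume "xs \<in> spaced_upto (Suc N) t \<union> ?B"
  then show "xs \<in> spaced_upto (Suc (Suc N)) t"
  proof
    assume "xs \<in> spaced_upto (Suc N) t"
    then show ?thesis by (auto simp: spaced_upto_def)
  next
    assume "xs \<in> ?B"
    then obtain ys where "Suc (Suc N) \<le> t" "xs = Suc (Suc N) # ys" "ys \<in> spaced_upto N (t - Suc (Suc N))"
      by (auto split: if_splits)
    moreover from this have "x \<le> Suc (Suc N)" if "x \<in> set ys" for x
      using that by (auto simp: spaced_upto_def intro: order_trans[of x N])
    ultimately show ?thesis by (auto simp: spaced_upto_def spaced_def)
  qed
qed

lemma schur_poly_nth:
  "finite (spaced_upto N t) \<and> fps_nth (schur_poly fps_X N) t = int (card (spaced_upto N t))"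
proof (induction N arbitrary: t rule: induct_nat_012)
  case (ge2 n)
  let ?B = "(#) (Suc (Suc n)) ` (if Suc (Suc n) \<le> t then spaced_upto n (t - Suc (Suc n)) else {})"
  have fin: "finite (spaced_upto (Suc n) t)" "finite ?B" using ge2 by simp_all
  have "spaced_upto (Suc n) t \<inter> ?B = {}"
    by (auto simp: spaced_upto_def)
  then have "card (spaced_upto (Suc (Suc n)) t) = card (spaced_upto (Suc n) t) + card ?B"
    unfolding spaced_upto_rec using fin by (rule card_Un_disjoint[rotated 2])
  moreover have "card ?B = (if Suc (Suc n) \<le> t then card (spaced_upto n (t - Suc (Suc n))) else 0)"
    by (simp add: card_image)
  moreover have "finite (spaced_upto (Suc (Suc n)) t)"
    unfolding spaced_upto_rec using fin by blast
  moreover have "fps_nth (schur_poly fps_X (Suc (Suc n))) t = fps_nth (schur_poly fps_X (Suc n)) t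
      + (if Suc (Suc n) \<le> t then fps_nth (schur_poly (fps_X :: int fps) n) (t - Suc (Suc n)) else 0)"
    by (simp only: schur_poly.simps fps_add_nth fps_X_power_mult_nth split: if_split) (auto simp: not_less)
  ultimately show ?case
    using ge2 by (simp only: of_nat_add) simp
next
  case 0
  show ?case by (simp add: spaced_upto_small)
next
  case 1
  show ?case by (simp add: spaced_upto_small)
qed

lemma finite_spaced: "finite (spaced t)"
  using schur_poly_nth[THEN conjunct1, of t t] unfolding spaced_upto_eq_spaced[OF order_refl] .

text \<open>For large \<open>m\<close> the two generating functions agree modulo \<open>q ^ Suc t\<close>, hence in the coefficient
  of \<open>q ^ t\<close>; the bounds \<open>2 * m\<close> and \<open>5 * m\<close> on the parts exceed \<open>t\<close> and so exclude nothing.\<close>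
theorem rogers_ramanujan_second: "card (spaced t) = card (partitions_into two_three_mod_five t)"
proof -
  define m where "m = 6 * Suc t + 1"
  define S where "S = {s \<in> two_three_mod_five. s < 5 * m}"
  have S: "finite S" "0 \<notin> S"
  proof -
    show "finite S" by (rule finite_subset[of _ "{..<5 * m}"]) (auto simp: S_def)
    show "0 \<notin> S" by (simp add: S_def two_three_mod_five_def)
  qed
  have "partitions_gf S * (\<Prod>i<m. (1 - fps_X ^ (5 * i + 2)) * (1 - fps_X ^ (5 * i + 3))) = 1"
    using partitions_gf_product[OF S] unfolding S_def prod_two_three_mod_five .
  then have "fps_X ^ Suc t dvd schur_poly (fps_X :: int fps) (2 * m) - partitions_gf S"
    by (rule schur_poly_product_limit[rotated]) (simp add: m_def)
  then obtain g where "schur_poly (fps_X :: int fps) (2 * m) - partitions_gf S = fps_X ^ Suc t * g" ..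
  then have "fps_nth (schur_poly (fps_X :: int fps) (2 * m) - partitions_gf S) t = 0"
    by (simp only: fps_X_power_mult_nth) simp
  then have "fps_nth (schur_poly (fps_X :: int fps) (2 * m)) t = int (card (partitions_into S t))"
    by (simp only: fps_sub_nth partitions_gf_def fps_nth_Abs_fps right_minus_eq)
  then have "int (card (spaced_upto (2 * m) t)) = int (card (partitions_into S t))"
    using schur_poly_nth[THEN conjunct2, of "2 * m" t] by (simp only:)
  moreover have "spaced_upto (2 * m) t = spaced t"
    by (rule spaced_upto_eq_spaced) (simp add: m_def)
  moreover have "partitions_into S t = partitions_into two_three_mod_five t"
  proof -
    have "a < 5 * m" if "a \<in># A" "sum_mset A = t" for a A
    proof -
      from multi_member_split[OF that(1)] obtain B where "A = add_mset a B" ..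
      then have "a \<le> t" using that(2) by simp
      then show ?thesis by (simp add: m_def)
    qed
    then have "set_mset A \<subseteq> S \<longleftrightarrow> set_mset A \<subseteq> two_three_mod_five" if "sum_mset A = t" for A
      unfolding S_def using that by blast
    then show ?thesis unfolding partitions_into_def by blast
  qed
  ultimately show ?thesis by simp
qed

section \<open>The refinement\<close>

definition spaced_gap :: "nat \<Rightarrow> nat \<Rightarrow> nat list set" where
  "spaced_gap t c = {xs \<in> spaced t. \<exists>x y ys. xs = x # y # ys \<and> y + 2 + c \<le> x}"

lemma spaced_Cons_Cons:
  "x # y # ys \<in> spaced t \<longleftrightarrow> y + 2 \<le> x \<and> x \<le> t \<and> y # ys \<in> spaced (t - x)"
proof
  assume "x # y # ys \<in> spaced t"
  then show "y + 2 \<le> x \<and> x \<le> t \<and> y # ys \<in> spaced (t - x)"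
    by (auto simp: spaced_def)
next
  assume R: "y + 2 \<le> x \<and> x \<le> t \<and> y # ys \<in> spaced (t - x)"
  then have "\<forall>z \<in> set ys. z + 2 \<le> y" by (simp add: spaced_def)
  then have "\<forall>z \<in> set ys. z + 2 \<le> x"
    using R by (meson add_leD1 le_trans)
  then show "x # y # ys \<in> spaced t"
    using R by (simp add: spaced_def)
qed

lemma spaced_gap_eq:
  "spaced_gap t c = {x # y # ys | x y ys. y + 2 + c \<le> x \<and> x \<le> t \<and> y # ys \<in> spaced (t - x)}"
proof -
  have "x # y # ys \<in> spaced t \<and> y + 2 + c \<le> x
      \<longleftrightarrow> y + 2 + c \<le> x \<and> x \<le> t \<and> y # ys \<in> spaced (t - x)" for x y ys
    unfolding spaced_Cons_Cons by auto
  moreover have "spaced_gap t c = {x # y # ys | x y ys. x # y # ys \<in> spaced t \<and> y + 2 + c \<le> x}"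
    by (auto simp: spaced_gap_def)
  ultimately show ?thesis by (simp only:)
qed

text \<open>The bijection lowers the largest part by \<open>c\<close>.\<close>
lemma card_spaced_gap:
  "card (spaced_gap t c) = (if c \<le> t then card (spaced_gap (t - c) 0) else 0)"
proof (cases "c \<le> t")
  case True
  have "bij_betw (\<lambda>xs. (hd xs + c) # tl xs) (spaced_gap (t - c) 0) (spaced_gap t c)"
  proof (rule bij_betw_byWitness[where f' = "\<lambda>xs. (hd xs - c) # tl xs"])
    show "(\<lambda>xs. (hd xs + c) # tl xs) ` spaced_gap (t - c) 0 \<subseteq> spaced_gap t c"
      unfolding spaced_gap_eq using True by (auto simp: algebra_simps)
    show "(\<lambda>xs. (hd xs - c) # tl xs) ` spaced_gap t c \<subseteq> spaced_gap (t - c) 0"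
      unfolding spaced_gap_eq by auto
  qed (auto simp: spaced_gap_def)
  then show ?thesis using True by (simp add: bij_betw_same_card)
next
  case False
  then have "spaced_gap t c = {}"
    by (auto simp: spaced_gap_def spaced_def)
  then show ?thesis using False by simp
qed

text \<open>The correction counts the empty partition and the partition with the single part \<open>t\<close>.\<close>
lemma card_spaced_split_short:
  "card (spaced t) = card (spaced_gap t 0) + (if t = 0 \<or> t \<ge> 2 then 1 else 0)"
proof -
  let ?short = "if t = 0 then {[]} else if t \<ge> 2 then {[t]} else {}"
  have "spaced t = spaced_gap t 0 \<union> ?short"
  proof (intro equalityI subsetI)
    fix xs assume "xs \<in> spaced t"
    then show "xs \<in> spaced_gap t 0 \<union> ?short"
      by (cases xs; cases "tl xs") (auto simp: spaced_gap_def spaced_def)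
  qed (auto simp: spaced_gap_def spaced_def split: if_splits)
  moreover have "spaced_gap t 0 \<inter> ?short = {}"
    by (auto simp: spaced_gap_def)
  moreover have "finite (spaced_gap t 0)"
    using finite_spaced by (auto simp: spaced_gap_def)
  ultimately have "card (spaced t) = card (spaced_gap t 0) + card ?short"
    by (simp only: card_Un_disjoint) (simp add: card_Un_disjoint)
  then show ?thesis by simp
qed

lemma card_descending_lists:
  "card {xs :: 'a::linorder list. sorted_wrt (\<ge>) xs \<and> P (mset xs)} = card {A. P A}"
proof (rule bij_betw_same_card)
  have inverse: "rev (sorted_list_of_multiset (mset xs)) = xs" if "sorted_wrt (\<ge>) xs" for xs :: "'a list"
  proof -
    have "sorted (rev xs)" using that by (simp add: sorted_wrt_rev)
    then have "sort (rev xs) = rev xs" by (rule sorted_sort_id)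
    moreover have "sorted_list_of_multiset (mset xs) = sort (rev xs)"
      using sorted_list_of_multiset_mset[of "rev xs"] by simp
    ultimately show ?thesis by simp
  qed
  have sorted: "sorted_wrt (\<ge>) (rev (sorted_list_of_multiset A))" for A :: "'a multiset"
    using sorted_sorted_list_of_multiset[of A] by (simp add: sorted_wrt_rev)
  show "bij_betw mset {xs :: 'a list. sorted_wrt (\<ge>) xs \<and> P (mset xs)} {A. P A}"
    by (rule bij_betw_byWitness[where f' = "\<lambda>A. rev (sorted_list_of_multiset A)"])
      (use inverse sorted in auto)
qed

lemma difference_partition_iff_spaced:
  "is_partition n xs \<and> difference_at_least_2 xs \<and> 1 \<notin> set xs \<longleftrightarrow> xs \<in> spaced n"
proof -
  have "transp (\<lambda>x y :: nat. y + 2 \<le> x)"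
    by (rule transpI) simp
  then have diff: "difference_at_least_2 xs \<longleftrightarrow> sorted_wrt (\<lambda>x y. y + 2 \<le> x) xs"
    by (auto simp: difference_at_least_2_def sorted_wrt_iff_nth_Suc_transp)
  have "sorted_wrt (\<ge>) xs" if "sorted_wrt (\<lambda>x y. y + 2 \<le> x) xs"
    using that by (rule sorted_wrt_mono_rel[rotated]) simp
  moreover have "(\<forall>x \<in> set xs. 1 \<le> x) \<and> 1 \<notin> set xs \<longleftrightarrow> (\<forall>x \<in> set xs. 2 \<le> x)"
  proof -
    have "1 \<le> x \<and> x \<noteq> 1 \<longleftrightarrow> 2 \<le> x" for x :: nat by auto
    then show ?thesis by metis
  qed
  ultimately show ?thesis
    unfolding diff is_partition_def spaced_def mem_Collect_eq by blast
qed

lemma int_card_Diff: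
  assumes "finite B" "A \<subseteq> B"
  shows "int (card (B - A)) = int (card B) - int (card A)"
  using card_Diff_subset[OF finite_subset[OF assms(2,1)] assms(2)] card_mono[OF assms]
  by (simp only: of_nat_diff)

lemma card_partitions_into_count_eq:
  assumes "M \<in> S" "0 \<notin> S"
  shows "int (card {A \<in> partitions_into S n. count A M = k})
    = (if k * M \<le> n then int (card (partitions_into S (n - k * M))) else 0)
      - (if Suc k * M \<le> n then int (card (partitions_into S (n - Suc k * M))) else 0)"
proof -
  have "{A \<in> partitions_into S n. count A M = k} = {A \<in> partitions_into S n. k \<le> count A M} - {A \<in> partitions_into S n. Suc k \<le> count A M}"
    by auto
  moreover have "{A \<in> partitions_into S n. Suc k \<le> count A M} \<subseteq> {A \<in> partitions_into S n. k \<le> count A M}" by auto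
  moreover have "finite {A \<in> partitions_into S n. k \<le> count A M}" using finite_partitions_into[OF assms(2)] by simp
  ultimately have "int (card {A \<in> partitions_into S n. count A M = k})
      = int (card {A \<in> partitions_into S n. k \<le> count A M}) - int (card {A \<in> partitions_into S n. Suc k \<le> count A M})"
    by (simp only: int_card_Diff)
  then show ?thesis
    unfolding card_partitions_into_count_ge[OF assms(1)] by simp
qed

lemma card_spaced_gap_between:
  "int (card (spaced_gap n a - spaced_gap n (a + b)))
    = (if a \<le> n then int (card (spaced_gap (n - a) 0)) else 0)
      - (if a + b \<le> n then int (card (spaced_gap (n - (a + b)) 0)) else 0)"
proof -
  have "spaced_gap n (a + b) \<subseteq> spaced_gap n a" by (auto simp: spaced_gap_def)
  moreover have "finite (spaced_gap n a)"
    using finite_spaced by (auto simp: spaced_gap_def)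
  ultimately have "int (card (spaced_gap n a - spaced_gap n (a + b)))
      = int (card (spaced_gap n a)) - int (card (spaced_gap n (a + b)))"
    by (simp only: int_card_Diff)
  then show ?thesis
    unfolding card_spaced_gap[of n a] card_spaced_gap[of n "a + b"] by simp
qed

lemma floor_gap_eq_iff:
  assumes "M > 0" "y + 2 \<le> x"
  shows "\<lfloor>(real x - real y - 2) / real M\<rfloor> = int k \<longleftrightarrow> y + 2 + k * M \<le> x \<and> \<not> y + 2 + (k * M + M) \<le> x"
proof -
  have "(real x - real y - 2) / real M = real (x - y - 2) / real M" using assms by simp
  then have "\<lfloor>(real x - real y - 2) / real M\<rfloor> = int ((x - y - 2) div M)"
    by (simp only: floor_divide_of_nat_eq)
  moreover have "(x - y - 2) div M = k \<longleftrightarrow> k \<le> (x - y - 2) div M \<and> (x - y - 2) div M < Suc k"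
    by auto
  ultimately have "\<lfloor>(real x - real y - 2) / real M\<rfloor> = int k
      \<longleftrightarrow> k * M \<le> x - y - 2 \<and> x - y - 2 < Suc k * M"
    using assms(1) by (simp only: less_eq_div_iff_mult_less_eq div_less_iff_less_mult of_nat_eq_iff)
  then show ?thesis using assms by auto
qed

theorem theorem2p2:
  fixes M n k :: nat
  assumes "M > 0" and "M mod 5 = 2 \<or> M mod 5 = 3" and "n \<ge> 1"
  shows "card {xs. is_partition n xs \<and> (\<forall>x \<in> set xs. x mod 5 = 2 \<or> x mod 5 = 3)
                 \<and> count_list xs M = k}
       = card {xs. is_partition n xs \<and> difference_at_least_2 xs \<and> 1 \<notin> set xs
                 \<and> (length xs = 1 \<longrightarrow>
                     (\<exists>j::int. int n = int M * int k + j
                        \<and> ((2 \<le> j \<and> j \<le> int M - 1) \<or> j = 0 \<or> j = int M + 1)))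
                 \<and> (length xs \<ge> 2 \<longrightarrow>
                     \<lfloor>(real (xs ! 0) - real (xs ! 1) - 2) / real M\<rfloor> = int k)}"
    (is "card ?L = card ?R")
proof -
  let ?S = two_three_mod_five
  have M: "M \<in> ?S" "0 \<notin> ?S" "M \<ge> 2"
    using assms(2) by (auto simp: two_three_mod_five_def intro: ccontr)
  have "?L = {xs. sorted_wrt (\<ge>) xs \<and> mset xs \<in> partitions_into ?S n \<and> count (mset xs) M = k}"
    by (auto simp: is_partition_def partitions_into_def two_three_mod_five_def sum_mset_sum_list count_mset intro: gr0I)
  then have L: "card ?L = card {A \<in> partitions_into ?S n. count A M = k}"
    using card_descending_lists[of "\<lambda>A. A \<in> partitions_into ?S n \<and> count A M = k"] by simp
  define single where "single \<longleftrightarrow> (\<exists>j::int. int n = int M * int k + j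
      \<and> ((2 \<le> j \<and> j \<le> int M - 1) \<or> j = 0 \<or> j = int M + 1))"
  define a where "a = k * M"
  let ?gap = "spaced_gap n a - spaced_gap n (a + M)"
  let ?one = "if single then {[n]} else {}"
  have single_iff: "single \<longleftrightarrow> n = a \<or> (a + 2 \<le> n \<and> n < a + M) \<or> n = a + M + 1"
  proof -
    have ex: "(\<exists>j::int. N = c + j \<and> Q j) \<longleftrightarrow> Q (N - c)" for N c Q
    proof
      assume "Q (N - c)"
      then show "\<exists>j. N = c + j \<and> Q j" by (intro exI[of _ "N - c"]) simp
    qed auto
    have "int M * int k = int a" by (simp add: a_def)
    then show ?thesis unfolding single_def ex by auto
  qed
  have single_ge: "n \<ge> 2" if single
  proof -
    have "a \<ge> M \<or> a = 0" unfolding a_def by (cases k) auto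
    then show ?thesis using that assms(3) M(3) unfolding single_iff by linarith
  qed
  have "xs \<in> ?R \<longleftrightarrow> xs \<in> ?gap \<union> ?one" for xs
  proof -
    have "xs \<in> ?R \<longleftrightarrow> xs \<in> spaced n \<and> (length xs = 1 \<longrightarrow> single) \<and> (length xs \<ge> 2 \<longrightarrow>
        \<lfloor>(real (xs ! 0) - real (xs ! 1) - 2) / real M\<rfloor> = int k)"
      unfolding mem_Collect_eq single_def[symmetric] difference_partition_iff_spaced[symmetric] by (simp only: conj_assoc)
    also have "\<dots> \<longleftrightarrow> xs \<in> ?gap \<union> ?one"
    proof (cases xs)
      case Nil
      then show ?thesis using assms(3) by (simp add: spaced_def spaced_gap_def)
    next
      case (Cons x zs)
      show ?thesis
      proof (cases zs)
        case Nil
        then show ?thesis using Cons single_ge by (auto simp: spaced_def spaced_gap_def)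
      next
        case (Cons y ys)
        then have xs: "xs = x # y # ys" using \<open>xs = x # zs\<close> by simp
        show ?thesis
        proof (cases "xs \<in> spaced n")
          case True
          then have "y + 2 \<le> x" unfolding xs spaced_Cons_Cons by blast
          then have "\<lfloor>(real x - real y - 2) / real M\<rfloor> = int k
              \<longleftrightarrow> y + 2 + a \<le> x \<and> \<not> y + 2 + (a + M) \<le> x"
            unfolding a_def by (rule floor_gap_eq_iff[OF assms(1)])
          moreover have "xs \<in> ?gap \<longleftrightarrow> y + 2 + a \<le> x \<and> \<not> y + 2 + (a + M) \<le> x"
            using True by (simp add: xs spaced_gap_def)
          moreover have "xs \<notin> ?one" by (simp add: xs)
          moreover have "xs ! 0 = x" "xs ! 1 = y" "length xs \<ge> 2" "length xs \<noteq> 1"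
            by (simp_all add: xs)
          ultimately show ?thesis using True by (simp only: Un_iff) simp
        next
          case False
          then show ?thesis by (auto simp: xs spaced_gap_def)
        qed
      qed
    qed
    finally show ?thesis .
  qed
  then have R_eq: "?R = ?gap \<union> ?one" by (rule set_eqI)
  have card_one: "card (?gap \<union> ?one) = card ?gap + card ?one"
  proof (rule card_Un_disjoint)
    show "finite ?gap" using finite_spaced by (auto simp: spaced_gap_def)
    show "?gap \<inter> ?one = {}" by (auto simp: spaced_gap_def)
  qed simp
  have R: "card ?R = card ?gap + (if single then 1 else 0)"
    unfolding R_eq card_one by simp
  \<comment> \<open>The common count \<open>A (n - c) = B (n - c)\<close>, extended by 0 to negative arguments.\<close>
  define h where "h c = (if c \<le> n then int (card (spaced (n - c))) else 0)" for c
  have h: "(if c \<le> n then int (card (spaced_gap (n - c) 0)) else 0)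
      = h c - (if c \<le> n \<and> (n = c \<or> n - c \<ge> 2) then 1 else 0)" for c
    using card_spaced_split_short[of "n - c"] by (auto simp: h_def)
  have h_partitions: "h c = (if c \<le> n then int (card (partitions_into ?S (n - c))) else 0)" for c
    by (simp add: h_def rogers_ramanujan_second)
  have "Suc k * M = a + M" by (simp add: a_def)
  then have "int (card ?L) = h a - h (a + M)"
    unfolding L card_partitions_into_count_eq[OF M(1,2)] h_partitions by (simp only: a_def)
  moreover have "int (if single then 1 else 0)
      = (if a \<le> n \<and> (n = a \<or> n - a \<ge> 2) then 1 else 0)
        - (if a + M \<le> n \<and> (n = a + M \<or> n - (a + M) \<ge> 2) then 1 else 0)"
    unfolding single_iff using M(3) by auto
  then have "int (card ?R) = h a - h (a + M)"
    unfolding R of_nat_add card_spaced_gap_between h by linarith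
  ultimately have "int (card ?R) = int (card ?L)" by simp
  then show ?thesis by simp
qed

end
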